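(* For each integer $n\ge 1$, consider the model in which $p_1,p_2$ are i.i.d. uniform on $(0,1)$ and $Y\mid p_1,p_2\sim\mathrm{Binomial}(n,p_1p_2)$. (a) For every $y\in\{0,1,\ldots,n\}$, the posterior expectation of $p_2$ (or, equally, of $p_1$) given $Y=y$ is $$\mathbb{E}(p_2\mid y)=\frac{1}{n+2}\,\mu_H\{y+1,y+2,\ldots,n+1\},$$ or, alternatively, $$\mathbb{E}(p_2\mid y)=\frac{(n-y+1)/(n+2)}{H_{n+1}-H_y}.$$ (b) For every fixed $\alpha\in(0,1)$, $$\lim_{n\to\infty}\mathbb{E}\big(p_2\mid Y=\lfloor\alpha n\rfloor\big)=\frac{1-\alpha}{-\ln(\alpha)}.$$
   Context: For positive reals $a_1,\ldots,a_N$, the harmonic mean is $\mu_H\{a_1,\ldots,a_N\}=\big\{\frac1N\sum_{i=1}^N a_i^{-1}\big\}^{-1}$. $H_m=1+\frac12+\cdots+\frac1m$ is the $m$-th harmonic number, with $H_0=0$. $\lfloor a\rfloor$ is the integer part of $a$. The posterior distribution of $(p_1,p_2)$ given $Y=y$ is the distribution on $(0,1)^2$ with density proportional to $(p_1p_2)^y(1-p_1p_2)^{n-y}$. *)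

theory Defs
  imports "HOL-Probability.Probability"
begin

text \<open>
  Lebesgue measure on the open unit interval is already a probability measure. Restricting the
  sample space (rather than using a density on all of \<^term>\<open>UNIV :: real set\<close>) matters:
  \<^term>\<open>binomial_pmf n p\<close> is unspecified for p outside the unit interval.
\<close>

definition uniform01 :: "real measure" where
  "uniform01 = restrict_space lborel {0<..<1}"

definition prior :: "(real \<times> real) measure" where
  "prior = uniform01 \<Otimes>\<^sub>M uniform01"

text \<open>The joint law of ((p1, p2), Y).\<close>

definition joint :: "nat \<Rightarrow> ((real \<times> real) \<times> nat) measure" where
  "joint n = prior \<bind>
     (\<lambda>p. distr (measure_pmf (binomial_pmf n (fst p * snd p)))
              (prior \<Otimes>\<^sub>M count_space UNIV) (Pair p))"

text \<open>
  The conditional law of (p1, p2) given Y = y. For y at most n the conditioning event has positive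
  probability (\<open>emeasure_joint_event\<close> below), and the law is the distribution on the open
  unit square whose density is proportional to the likelihood kernel (\<open>posterior_eq_density\<close>
  below).
\<close>

definition posterior :: "nat \<Rightarrow> nat \<Rightarrow> (real \<times> real) measure" where
  "posterior n y =
     distr (uniform_measure (joint n) {\<omega> \<in> space (joint n). snd \<omega> = y}) prior fst"

definition posterior_expectation :: "nat \<Rightarrow> nat \<Rightarrow> (real \<times> real \<Rightarrow> real) \<Rightarrow> real" where
  "posterior_expectation n y f = (\<integral>p. f p \<partial>posterior n y)"

definition harmonic_mean :: "'i set \<Rightarrow> ('i \<Rightarrow> real) \<Rightarrow> real" where
  "harmonic_mean I a = inverse (1 / real (card I) * (\<Sum>i\<in>I. inverse (a i)))"

definition lik_kernel :: "nat \<Rightarrow> nat \<Rightarrow> real \<times> real \<Rightarrow> real" where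
  "lik_kernel n y p = (fst p * snd p) ^ y * (1 - fst p * snd p) ^ (n - y)"

lemma space_uniform01 [simp]: "space uniform01 = {0<..<1}"
  by (simp add: uniform01_def space_restrict_space)

lemma space_prior: "space prior = {0<..<1} \<times> {0<..<1}"
  by (simp add: prior_def space_pair_measure)

lemma prob_space_uniform01: "prob_space uniform01"
  by (rule prob_spaceI) (simp add: uniform01_def emeasure_restrict_space space_restrict_space)

lemma prob_space_prior: "prob_space prior"
proof -
  interpret prob_space uniform01 by (rule prob_space_uniform01)
  interpret pair_prob_space uniform01 uniform01 ..
  show ?thesis unfolding prior_def by (rule prob_space_axioms)
qed

lemma measurable_uniform01_borel: "(\<lambda>x. x) \<in> borel_measurable uniform01"
  unfolding uniform01_def by (rule measurable_restrict_space1) simp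

lemma measurable_fst_prior [measurable]: "fst \<in> borel_measurable prior"
  unfolding prior_def by (rule measurable_compose[OF measurable_fst measurable_uniform01_borel])

lemma measurable_snd_prior [measurable]: "snd \<in> borel_measurable prior"
  unfolding prior_def by (rule measurable_compose[OF measurable_snd measurable_uniform01_borel])

lemma measurable_lik_kernel [measurable]: "lik_kernel n y \<in> borel_measurable prior"
  unfolding lik_kernel_def by measurable

lemma prior_prod_bounds:
  assumes "p \<in> space prior"
  shows "0 < fst p * snd p" "fst p * snd p < 1"
proof -
  have "0 < fst p" "fst p < 1" "0 < snd p" "snd p < 1"
    using assms by (auto simp: space_prior)
  then show "0 < fst p * snd p" "fst p * snd p < 1"
    using mult_strict_mono[of "fst p" 1 "snd p" 1] by auto
qed

lemma lik_kernel_pos: "p \<in> space prior \<Longrightarrow> 0 < lik_kernel n y p"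
  using prior_prod_bounds[of p] by (simp add: lik_kernel_def)

lemma lik_kernel_le_1: "p \<in> space prior \<Longrightarrow> lik_kernel n y p \<le> 1"
  using prior_prod_bounds[of p] unfolding lik_kernel_def
  by (intro mult_le_one) (simp_all add: power_le_one del: power_mult_distrib)

lemma pmf_binomial_prior:
  "p \<in> space prior \<Longrightarrow> pmf (binomial_pmf n (fst p * snd p)) y = real (n choose y) * lik_kernel n y p"
  using prior_prod_bounds[of p] by (simp add: lik_kernel_def)

lemma integrable_kernel: "integrable prior (lik_kernel n y)"
proof -
  interpret prob_space prior by (rule prob_space_prior)
  have "AE p in prior. norm (lik_kernel n y p) \<le> 1"
    using lik_kernel_pos lik_kernel_le_1 by (intro AE_I2) (force simp: less_imp_le)
  then show ?thesis by (intro integrable_const_bound[of _ 1]) auto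
qed

lemma integral_kernel_pos: "0 < (\<integral>p. lik_kernel n y p \<partial>prior)"
proof -
  interpret prob_space prior by (rule prob_space_prior)
  have "(\<integral>p. lik_kernel n y p \<partial>prior) \<noteq> 0"
  proof
    assume "(\<integral>p. lik_kernel n y p \<partial>prior) = 0"
    then have "AE p in prior. lik_kernel n y p = 0"
      by (subst (asm) integral_nonneg_eq_0_iff_AE[OF integrable_kernel])
         (auto intro!: AE_I2 less_imp_le lik_kernel_pos)
    then have "AE p in prior. False"
      by (rule AE_mp) (intro AE_I2, auto dest: lik_kernel_pos[of _ n y])
    then show False by simp
  qed
  moreover have "0 \<le> (\<integral>p. lik_kernel n y p \<partial>prior)"
    by (intro integral_nonneg_AE AE_I2 less_imp_le lik_kernel_pos)
  ultimately show ?thesis by simp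
qed

lemma joint_kernel_measurable [measurable]:
  "(\<lambda>p. distr (measure_pmf (binomial_pmf n (fst p * snd p)))
              (prior \<Otimes>\<^sub>M count_space UNIV) (Pair p))
     \<in> prior \<rightarrow>\<^sub>M subprob_algebra (prior \<Otimes>\<^sub>M count_space UNIV)"
proof -
  let ?B = "\<lambda>p. measure_pmf (binomial_pmf n (fst p * snd p))"
  have B: "?B \<in> prior \<rightarrow>\<^sub>M subprob_algebra (count_space UNIV)"
  proof (rule measurable_subprob_algebra)
    fix A :: "nat set"
    have fin: "finite (A \<inter> {..n})" by simp
    have "emeasure (?B p) A = (\<Sum>y\<in>A \<inter> {..n}. ennreal (real (n choose y) * lik_kernel n y p))"
      if p: "p \<in> space prior" for p
    proof -
      have "emeasure (?B p) A = emeasure (?B p) (A \<inter> set_pmf (binomial_pmf n (fst p * snd p)))"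
        by (rule emeasure_Int_set_pmf[symmetric])
      also have "set_pmf (binomial_pmf n (fst p * snd p)) = {..n}"
        using prior_prod_bounds[OF p] by (intro set_pmf_binomial)
      finally show ?thesis
        using p lik_kernel_pos[OF p]
        by (simp add: emeasure_measure_pmf_finite[OF fin] pmf_binomial_prior less_imp_le)
    qed
    then show "(\<lambda>p. emeasure (?B p) A) \<in> borel_measurable prior"
      by (subst measurable_cong) auto
  qed (simp_all add: prob_space_imp_subprob_space prob_space_measure_pmf)

  show ?thesis
    by (rule measurable_distr2[OF _ B]) simp
qed

lemma sets_joint [measurable_cong]: "sets (joint n) = sets (prior \<Otimes>\<^sub>M count_space UNIV)"
  unfolding joint_def
  by (rule sets_bind) (auto simp: prob_space.not_empty[OF prob_space_prior])

lemma space_joint: "space (joint n) = space prior \<times> UNIV"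
  using sets_eq_imp_space_eq[OF sets_joint] by (simp add: space_pair_measure)

lemma prob_space_joint: "prob_space (joint n)"
  unfolding joint_def
proof (rule prob_space.prob_space_bind[OF prob_space_prior _ joint_kernel_measurable])
  show "AE p in prior. prob_space (distr (measure_pmf (binomial_pmf n (fst p * snd p)))
          (prior \<Otimes>\<^sub>M count_space UNIV) (Pair p))"
    by (intro AE_I2 measure_pmf.prob_space_distr)
       (auto simp: measurable_count_space_eq1 space_pair_measure)
qed

lemma emeasure_joint_rect:
  assumes A: "A \<in> sets prior"
  shows "emeasure (joint n) (A \<times> {y}) =
    ennreal (real (n choose y)) * (\<integral>\<^sup>+p. ennreal (lik_kernel n y p) * indicator A p \<partial>prior)"
proof -
  have S: "A \<times> {y} \<in> sets (prior \<Otimes>\<^sub>M count_space UNIV)"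
    using A by (intro pair_measureI) auto
  have "emeasure (joint n) (A \<times> {y}) =
      (\<integral>\<^sup>+p. emeasure (distr (measure_pmf (binomial_pmf n (fst p * snd p)))
              (prior \<Otimes>\<^sub>M count_space UNIV) (Pair p)) (A \<times> {y}) \<partial>prior)"
    unfolding joint_def
    by (rule emeasure_bind[OF _ joint_kernel_measurable S])
       (simp add: prob_space.not_empty[OF prob_space_prior])
  also have "\<dots> = (\<integral>\<^sup>+p. ennreal (real (n choose y)) * (ennreal (lik_kernel n y p) * indicator A p) \<partial>prior)"
  proof (rule nn_integral_cong)
    fix p assume p: "p \<in> space prior"
    have "emeasure (distr (measure_pmf (binomial_pmf n (fst p * snd p)))
              (prior \<Otimes>\<^sub>M count_space UNIV) (Pair p)) (A \<times> {y}) =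
        emeasure (measure_pmf (binomial_pmf n (fst p * snd p))) (Pair p -` (A \<times> {y}))"
      using p S
      by (subst emeasure_distr) (auto simp: measurable_count_space_eq1 space_pair_measure)
    also have "Pair p -` (A \<times> {y}) = (if p \<in> A then {y} else {})" by auto
    also have "emeasure (measure_pmf (binomial_pmf n (fst p * snd p))) \<dots> =
        ennreal (real (n choose y)) * (ennreal (lik_kernel n y p) * indicator A p)"
      using p lik_kernel_pos[OF p, of n y]
      by (auto simp: emeasure_pmf_single pmf_binomial_prior ennreal_mult less_imp_le)
    finally show "emeasure (distr (measure_pmf (binomial_pmf n (fst p * snd p)))
              (prior \<Otimes>\<^sub>M count_space UNIV) (Pair p)) (A \<times> {y}) =
        ennreal (real (n choose y)) * (ennreal (lik_kernel n y p) * indicator A p)" .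
  qed
  also have "\<dots> = ennreal (real (n choose y)) *
      (\<integral>\<^sup>+p. ennreal (lik_kernel n y p) * indicator A p \<partial>prior)"
    using A by (intro nn_integral_cmult) simp
  finally show ?thesis .
qed

lemma emeasure_joint_event:
  "emeasure (joint n) {\<omega> \<in> space (joint n). snd \<omega> = y} =
    ennreal (real (n choose y) * (\<integral>p. lik_kernel n y p \<partial>prior))"
proof -
  have "{\<omega> \<in> space (joint n). snd \<omega> = y} = space prior \<times> {y}"
    by (auto simp: space_joint)
  moreover have "(\<integral>\<^sup>+p. ennreal (lik_kernel n y p) * indicator (space prior) p \<partial>prior) =
      ennreal (\<integral>p. lik_kernel n y p \<partial>prior)"
    by (subst nn_integral_eq_integral[OF integrable_kernel, symmetric])
       (auto intro!: AE_I2 nn_integral_cong less_imp_le lik_kernel_pos)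
  ultimately show ?thesis
    using integral_kernel_pos[of n y] by (simp add: emeasure_joint_rect ennreal_mult)
qed

lemma posterior_eq_density:
  assumes "y \<le> n"
  shows "posterior n y = density prior (\<lambda>p. ennreal (lik_kernel n y p / (\<integral>q. lik_kernel n y q \<partial>prior)))"
proof (rule measure_eqI)
  show "sets (posterior n y) =
      sets (density prior (\<lambda>p. ennreal (lik_kernel n y p / (\<integral>q. lik_kernel n y q \<partial>prior))))"
    by (simp add: posterior_def)
next
  fix A assume "A \<in> sets (posterior n y)"
  then have A [measurable]: "A \<in> sets prior" by (simp add: posterior_def)
  let ?Z = "\<integral>q. lik_kernel n y q \<partial>prior"
  let ?E = "{\<omega> \<in> space (joint n). snd \<omega> = y}"
  let ?c = "real (n choose y)"
  let ?I = "\<integral>\<^sup>+p. ennreal (lik_kernel n y p) * indicator A p \<partial>prior"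
  have Z: "0 < ?Z" by (rule integral_kernel_pos)
  have c: "0 < ?c" using assms by simp
  have E: "?E \<in> sets (joint n)" by measurable
  have f: "fst \<in> uniform_measure (joint n) ?E \<rightarrow>\<^sub>M prior" by measurable
  have "emeasure (posterior n y) A =
      emeasure (uniform_measure (joint n) ?E) (fst -` A \<inter> space (joint n))"
    unfolding posterior_def by (subst emeasure_distr[OF f A]) simp
  also have "\<dots> = emeasure (joint n) (?E \<inter> (fst -` A \<inter> space (joint n))) / emeasure (joint n) ?E"
    using E by (intro emeasure_uniform_measure) measurable
  also have "?E \<inter> (fst -` A \<inter> space (joint n)) = A \<times> {y}"
    using sets.sets_into_space[OF A] by (auto simp: space_joint)
  also have "emeasure (joint n) (A \<times> {y}) / emeasure (joint n) ?E =
      (ennreal ?c * ?I) / (ennreal ?c * ennreal ?Z)"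
    unfolding emeasure_joint_event emeasure_joint_rect[OF A] using Z by (simp add: ennreal_mult)
  also have "\<dots> = ?I / ennreal ?Z"
    unfolding mult.commute[of "ennreal ?c"] using c by (intro divide_mult_eq) auto
  also have "\<dots> = (\<integral>\<^sup>+p. ennreal (lik_kernel n y p) * indicator A p / ennreal ?Z \<partial>prior)"
    by (intro nn_integral_divide[symmetric]) measurable
  also have "\<dots> = (\<integral>\<^sup>+p. ennreal (lik_kernel n y p / ?Z) * indicator A p \<partial>prior)"
    using Z
    by (intro nn_integral_cong)
       (auto simp: divide_ennreal less_imp_le lik_kernel_pos indicator_def)
  also have "\<dots> = emeasure (density prior (\<lambda>p. ennreal (lik_kernel n y p / ?Z))) A"
    by (subst emeasure_density) auto
  finally show "emeasure (posterior n y) A =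
      emeasure (density prior (\<lambda>p. ennreal (lik_kernel n y p / ?Z))) A" .
qed

end

theory Submission
  imports Defs "HOL-Real_Asymp.Real_Asymp"
begin

text \<open>
  For i.i.d. uniform \<open>p1, p2\<close> the mixed moments factor, which settles the integrals of
  \<open>(p1 p2)^y (1 - p1 p2)^m\<close>, with and without an extra factor \<open>p2\<close>, for \<open>m = 0\<close>. Splitting off one
  factor \<open>1 - p1 p2\<close> expresses the integral with parameters \<open>(y, m + 1)\<close> as the difference of those
  with \<open>(y, m)\<close> and \<open>(y + 1, m)\<close>. This recurrence yields \<open>y! m! / (y + m + 1)! (H_{y+m+1} - H_y)\<close>
  for the normalising constant and \<open>y! (m + 1)! / (y + m + 2)!\<close> for the numerator of the posterior
  mean. The limit follows from \<open>H_k - ln k\<close> converging to Euler's constant.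
\<close>

section \<open>Moments of the uniform prior\<close>

lemma integral_power_uniform01: "(\<integral>x. x ^ k \<partial>uniform01) = 1 / real (Suc k)"
proof -
  have "(\<integral>x. x ^ k \<partial>uniform01) = (\<integral>x. indicator {0<..<1} x *\<^sub>R x ^ k \<partial>lborel)"
    by (simp add: uniform01_def integral_restrict_space)
  \<comment> \<open>The two integrands can differ only at the null points 0 and 1; the closed
    interval is the form that \<open>integral_power\<close> evaluates.\<close>
  also have "\<dots> = (\<integral>x. x ^ k * indicator {0..1} x \<partial>lborel)"
  proof (rule integral_cong_AE)
    show "AE x in lborel. indicator {0<..<1} x *\<^sub>R (x ^ k :: real) = x ^ k * indicator {0..1} x"
      using AE_lborel_singleton[of 0] AE_lborel_singleton[of 1]
      by eventually_elim (auto simp: indicator_def)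
  qed auto
  finally show ?thesis
    using integral_power[of 0 1 k] by simp
qed

lemma integrable_moment_prior: "integrable prior (\<lambda>p. fst p ^ a * snd p ^ b)"
proof -
  interpret prob_space prior by (rule prob_space_prior)
  have "AE p in prior. norm (fst p ^ a * snd p ^ b) \<le> 1"
    by (intro AE_I2) (auto simp: space_prior abs_mult power_le_one intro!: mult_le_one)
  then show ?thesis by (intro integrable_const_bound[of _ 1]) auto
qed

lemma integral_moment_prior:
  "(\<integral>p. fst p ^ a * snd p ^ b \<partial>prior) = 1 / (real (Suc a) * real (Suc b))"
proof -
  interpret prob_space uniform01 by (rule prob_space_uniform01)
  interpret pair_prob_space uniform01 uniform01 ..
  have "(\<integral>p. fst p ^ a * snd p ^ b \<partial>prior) =
      (\<integral>x. (\<integral>y. x ^ a * y ^ b \<partial>uniform01) \<partial>uniform01)"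
    using integral_fst'[OF integrable_moment_prior[of a b, unfolded prior_def]]
    by (simp add: prior_def)
  then show ?thesis
    by (simp add: integral_power_uniform01)
qed

section \<open>Normalising constant and numerator of the posterior mean\<close>

text \<open>Raising both indices keeps the exponent \<open>n - y\<close> of 1 - p1 p2, so the
  subtracted term is p1 p2 times the kernel for (n, y). The assumption gives
  \<open>Suc n - y = Suc (n - y)\<close> in truncated subtraction.\<close>

lemma lik_kernel_Suc:
  assumes "y \<le> n"
  shows "lik_kernel (Suc n) y p = lik_kernel n y p - lik_kernel (Suc n) (Suc y) p"
  using assms by (simp add: lik_kernel_def Suc_diff_le algebra_simps)

text \<open>Writing n as \<open>y + m\<close> makes the exponent of 1 - p1 p2 the induction
  variable; y stays arbitrary because the recurrence also uses the hypothesis at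
  \<open>Suc y\<close>.\<close>

lemma integral_kernel:
  "(\<integral>p. lik_kernel (y + m) y p \<partial>prior) =
    fact y * fact m / fact (y + m + 1) * (harm (y + m + 1) - harm y)"
proof (induction m arbitrary: y)
  case 0
  then show ?case
    using integral_moment_prior[of y y]
    by (simp add: lik_kernel_def power_mult_distrib harm_Suc divide_simps)
next
  case (Suc m)
  define r s w :: real
    where "r = fact (y + m + 1)" and "s = real (y + m + 2)" and "w = real (y + 1)"
  define h k :: real where "h = harm (y + m + 1)" and "k = harm y"
  have rs: "r > 0" "s > 0" "w > 0" by (simp_all add: r_def s_def w_def)
  have "(\<integral>p. lik_kernel (y + Suc m) y p \<partial>prior) =
      (\<integral>p. lik_kernel (y + m) y p \<partial>prior) - (\<integral>p. lik_kernel (Suc y + m) (Suc y) p \<partial>prior)"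
    using integrable_kernel by (simp add: lik_kernel_Suc)
  also have "\<dots> = fact y * fact m / r * (h - k) -
      fact y * w * fact m / (s * r) * (h + 1 / s - (k + 1 / w))"
    by (simp only: Suc.IH) (simp add: r_def s_def w_def h_def k_def harm_Suc field_simps)
  \<comment> \<open>Over the common denominator \<open>s * r\<close> the bracket is (s - w) (h - k)
    + 1 - w / s, and 1 - w / s = (s - w) / s, so s - w = m + 1 factors out.\<close>
  also have "\<dots> = fact y * (real (m + 1) * fact m) / (s * r) * (h + 1 / s - k)"
  proof -
    have m: "real (m + 1) = s - w" by (simp add: s_def w_def)
    show ?thesis unfolding m using rs by (simp add: field_simps)
  qed
  also have "\<dots> = fact y * fact (Suc m) / fact (y + Suc m + 1) * (harm (y + Suc m + 1) - harm y)"
    by (simp add: r_def s_def h_def k_def harm_Suc field_simps)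
  finally show ?case .
qed

lemma integrable_snd_kernel: "integrable prior (\<lambda>p. snd p * lik_kernel n y p)"
proof (rule Bochner_Integration.integrable_bound[OF integrable_kernel])
  show "AE p in prior. norm (snd p * lik_kernel n y p) \<le> norm (lik_kernel n y p)"
    by (intro AE_I2) (auto simp: space_prior abs_mult intro!: mult_left_le_one_le)
qed simp

text \<open>The recurrence survives multiplication by p2. Its base value 1 / ((y + 1) (y + 2)) is
  already a quotient of factorials, and each step preserves this shape, so no harmonic numbers
  arise.\<close>

lemma integral_snd_kernel:
  "(\<integral>p. snd p * lik_kernel (y + m) y p \<partial>prior) = fact y * fact (m + 1) / fact (y + m + 2)"
proof (induction m arbitrary: y)
  case 0
  then show ?case
    using integral_moment_prior[of y "Suc y"]
    by (simp add: lik_kernel_def power_mult_distrib divide_simps)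
       (simp add: algebra_simps)
next
  case (Suc m)
  define r s :: real where "r = fact (y + m + 2)" and "s = real (y + m + 3)"
  have rs: "r > 0" "s > 0" by (simp_all add: r_def s_def)
  have "(\<integral>p. snd p * lik_kernel (y + Suc m) y p \<partial>prior) =
      (\<integral>p. snd p * lik_kernel (y + m) y p \<partial>prior) -
      (\<integral>p. snd p * lik_kernel (Suc y + m) (Suc y) p \<partial>prior)"
    using integrable_snd_kernel by (simp add: lik_kernel_Suc right_diff_distrib)
  also have "\<dots> = fact y * fact (m + 1) / r - fact y * real (y + 1) * fact (m + 1) / (s * r)"
    by (simp only: Suc.IH) (simp add: r_def s_def field_simps)
  also have "\<dots> = fact y * (real (m + 2) * fact (m + 1)) / (s * r)"
  proof -
    have m: "real (m + 2) = s - real (y + 1)" by (simp add: s_def)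
    show ?thesis unfolding m using rs by (simp add: field_simps)
  qed
  also have "\<dots> = fact y * fact (Suc m + 1) / fact (y + Suc m + 2)"
    by (simp add: r_def s_def field_simps)
  finally show ?case .
qed

section \<open>Closed forms of the posterior mean\<close>

lemma integral_prior_swap:
  fixes f :: "real \<times> real \<Rightarrow> real"
  assumes "f \<in> borel_measurable prior"
  shows "(\<integral>p. f (prod.swap p) \<partial>prior) = (\<integral>p. f p \<partial>prior)"
proof -
  interpret prob_space uniform01 by (rule prob_space_uniform01)
  interpret pair_prob_space uniform01 uniform01 ..
  show ?thesis
    using integral_product_swap[of f] assms
    by (simp add: prior_def case_prod_unfold prod.swap_def)
qed

text \<open>The kernel depends on p only through p1 p2, and exchanging the coordinates preserves
  \<open>prior\<close>.\<close>

lemma integral_fst_kernel: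
  "(\<integral>p. fst p * lik_kernel n y p \<partial>prior) = (\<integral>p. snd p * lik_kernel n y p \<partial>prior)"
  by (subst integral_prior_swap[symmetric]) (simp_all add: lik_kernel_def mult.commute)

lemma posterior_expectation_eq:
  assumes "y \<le> n" and [measurable]: "f \<in> borel_measurable prior"
  shows "posterior_expectation n y f =
    (\<integral>p. f p * lik_kernel n y p \<partial>prior) / (\<integral>p. lik_kernel n y p \<partial>prior)"
proof -
  have "posterior_expectation n y f =
      (\<integral>p. lik_kernel n y p / (\<integral>q. lik_kernel n y q \<partial>prior) * f p \<partial>prior)"
    unfolding posterior_expectation_def posterior_eq_density[OF assms(1)]
    using integral_kernel_pos[of n y]
    by (subst integral_density) (auto intro!: AE_I2 less_imp_le divide_pos_pos lik_kernel_pos)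
  also have "\<dots> = (\<integral>p. f p * lik_kernel n y p / (\<integral>q. lik_kernel n y q \<partial>prior) \<partial>prior)"
    by (simp add: mult.commute)
  finally show ?thesis by simp
qed

lemma posterior_expectation_snd:
  assumes "y \<le> n"
  shows "posterior_expectation n y snd =
    ((real n - real y + 1) / real (n + 2)) / (harm (n + 1) - harm y)"
proof -
  obtain m where n: "n = y + m" using assms le_Suc_ex by blast
  have "posterior_expectation n y snd = (fact y * fact (m + 1) / fact (y + m + 2)) /
      (fact y * fact m / fact (y + m + 1) * (harm (y + m + 1) - harm y))"
    using assms by (simp add: posterior_expectation_eq n integral_kernel integral_snd_kernel
        del: fact_Suc)
  also have "\<dots> = (real (m + 1) / real (y + m + 2)) / (harm (y + m + 1) - harm y)"
  \<comment> \<open>Peeling one factor off each of the two larger factorials leaves m + 1 = n - y +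
    1 and y + m + 2 = n + 2; everything else cancels.\<close>
  proof -
    have "fact (m + 1) = real (m + 1) * fact m"
      and "fact (y + m + 2) = real (y + m + 2) * fact (y + m + 1)"
      by (simp_all add: algebra_simps)
    then show ?thesis
      by (simp del: fact_Suc of_nat_add of_nat_Suc add: divide_simps)
  qed
  finally show ?thesis by (simp add: n)
qed

lemma posterior_expectation_fst:
  assumes "y \<le> n"
  shows "posterior_expectation n y fst = posterior_expectation n y snd"
  using assms by (simp add: posterior_expectation_eq integral_fst_kernel)

lemma harmonic_mean_atLeastAtMost:
  assumes "y \<le> n"
  shows "harmonic_mean {y+1..n+1} real = (real n - real y + 1) / (harm (n + 1) - harm y)"
proof -
  \<comment> \<open>The reciprocals from y + 1 to n + 1 are a tail of a harmonic sum, with n - y + 1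
    terms.\<close>
  have "{1..n+1} = {1..y} \<union> {y+1..n+1}" using assms by auto
  then have "(\<Sum>i\<in>{y+1..n+1}. inverse (real i)) = harm (n + 1) - harm y"
    unfolding harm_def by (simp add: sum.union_disjoint)
  then show ?thesis
    using assms by (simp add: harmonic_mean_def Suc_diff_le of_nat_diff divide_inverse add.commute)
qed

section \<open>The limit for a fixed success fraction\<close>

text \<open>Euler's constant is the limit of H_k - ln k along both index sequences, so it cancels
  and only the logarithm of the ratio remains.\<close>

lemma harm_diff_tendsto:
  fixes f g :: "nat \<Rightarrow> nat"
  assumes f: "filterlim f at_top sequentially" and g: "filterlim g at_top sequentially"
    and fg: "(\<lambda>n. real (f n) / real (g n)) \<longlonglongrightarrow> c" and "c > 0"
  shows "(\<lambda>n. harm (f n) - harm (g n) :: real) \<longlonglongrightarrow> ln c"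
proof -
  have lim: "(\<lambda>n. harm (u n) - ln (real (u n))) \<longlonglongrightarrow> (euler_mascheroni :: real)"
    if "filterlim u at_top sequentially" for u
    using filterlim_compose[OF euler_mascheroni_LIMSEQ that] .
  have "(\<lambda>n. (harm (f n) - ln (real (f n))) - (harm (g n) - ln (real (g n)))
      + ln (real (f n) / real (g n))) \<longlonglongrightarrow> euler_mascheroni - euler_mascheroni + ln c"
    using \<open>c > 0\<close> by (intro tendsto_intros lim f g fg) auto
  \<comment> \<open>Splitting the logarithm of the quotient uses positive indices, which are
    available for large n.\<close>
  moreover have "\<forall>\<^sub>F n in sequentially. f n > 0 \<and> g n > 0"
    using eventually_compose_filterlim[OF eventually_gt_at_top f]
      eventually_compose_filterlim[OF eventually_gt_at_top g]
    by (intro eventually_conj)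
  then have "\<forall>\<^sub>F n in sequentially. (harm (f n) - ln (real (f n))) - (harm (g n) - ln (real (g n)))
      + ln (real (f n) / real (g n)) = harm (f n) - harm (g n)"
    by eventually_elim (simp add: ln_div)
  ultimately show ?thesis by (simp add: tendsto_cong)
qed

lemma posterior_expectation_tendsto:
  fixes \<alpha> :: real
  assumes "0 < \<alpha>" "\<alpha> < 1"
  shows "(\<lambda>n. posterior_expectation n (nat \<lfloor>\<alpha> * real n\<rfloor>) snd) \<longlonglongrightarrow> (1 - \<alpha>) / (- ln \<alpha>)"
proof -
  let ?y = "\<lambda>n. nat \<lfloor>\<alpha> * real n\<rfloor>"
  have "(\<lambda>n. harm (n + 1) - harm (?y n) :: real) \<longlonglongrightarrow> ln (inverse \<alpha>)"
  proof (rule harm_diff_tendsto)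
    show "filterlim ?y at_top sequentially" using assms by real_asymp
    show "(\<lambda>n. real (n + 1) / real (?y n)) \<longlonglongrightarrow> inverse \<alpha>"
      using assms by real_asymp
  qed (use assms in \<open>auto simp: filterlim_Suc\<close>)
  moreover have "(\<lambda>n. (real n - real (?y n) + 1) / real (n + 2)) \<longlonglongrightarrow> 1 - \<alpha>"
    using assms by real_asymp
  \<comment> \<open>The limit of the denominator is ln (1 / \<alpha>) = - ln \<alpha>, which is
    nonzero as 0 < \<alpha> < 1.\<close>
  ultimately have "(\<lambda>n. ((real n - real (?y n) + 1) / real (n + 2)) / (harm (n + 1) - harm (?y n)))
      \<longlonglongrightarrow> (1 - \<alpha>) / (- ln \<alpha>)"
    using assms by (intro tendsto_divide) (auto simp: ln_inverse)
  \<comment> \<open>This makes the closed form of the posterior mean applicable at every n.\<close>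
  moreover have "?y n \<le> n" for n
  proof -
    have "\<alpha> * real n \<le> real n" using assms by (simp add: mult_left_le_one_le)
    then show ?thesis by linarith
  qed
  ultimately show ?thesis by (simp add: posterior_expectation_snd)
qed

theorem corollary1:
  shows "(\<forall>n y :: nat. 1 \<le> n \<longrightarrow> y \<le> n \<longrightarrow>
            posterior_expectation n y snd = 1 / real (n + 2) * harmonic_mean {y+1..n+1} real \<and>
            posterior_expectation n y fst = 1 / real (n + 2) * harmonic_mean {y+1..n+1} real \<and>
            posterior_expectation n y snd =
              ((real n - real y + 1) / real (n + 2)) / (harm (n + 1) - harm y) \<and>
            posterior_expectation n y fst =
              ((real n - real y + 1) / real (n + 2)) / (harm (n + 1) - harm y)) \<and>
         (\<forall>\<alpha> :: real. 0 < \<alpha> \<and> \<alpha> < 1 \<longrightarrow>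
            (\<lambda>n. posterior_expectation n (nat \<lfloor>\<alpha> * real n\<rfloor>) snd)
              \<longlonglongrightarrow> (1 - \<alpha>) / (- ln \<alpha>))"
proof (intro conjI allI impI)
  fix \<alpha> :: real assume "0 < \<alpha> \<and> \<alpha> < 1"
  then show "(\<lambda>n. posterior_expectation n (nat \<lfloor>\<alpha> * real n\<rfloor>) snd)
      \<longlonglongrightarrow> (1 - \<alpha>) / (- ln \<alpha>)"
    by (intro posterior_expectation_tendsto) auto
qed (simp_all only: posterior_expectation_fst posterior_expectation_snd
      harmonic_mean_atLeastAtMost, simp_all)

end
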